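(* Let $\overline{\mathsf{SNR}}_0^{(i)}(\theta,D/L)$, $i=1,2$, be the functions defined in the context (case of two transmit and three receive polarizations). For any fixed $\theta\in(-\pi/2,\pi/2)$, as $D/L\to\infty$, $$\overline{\mathsf{SNR}}_0^{(1)}(\theta,D/L)=\frac{\pi}{4}\left[\left(\frac DL\right)^2\tan^2\theta-\frac{4\cos^4\theta-16\cos^2\theta+10}{3\cos^2\theta}\right]+O\left((L/D)^2\right),$$ $$\overline{\mathsf{SNR}}_0^{(2)}(\theta,D/L)=\frac{3\pi}{2\cos^4\theta}\left[\left(\frac DL\right)^4-2B_1(\theta)\left(\frac DL\right)^2+B_2(\theta)\right]+O\left((L/D)^2\right),$$ where $$B_1(\theta)=\frac{5\cos^4\theta-177\cos^2\theta+128}{60},$$ $$B_2(\theta)=\frac{-350\cos^6\theta+10242\cos^4\theta-19311\cos^2\theta+10122}{1575}.$$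
   Context: For $D>0$, $L>0$, $\theta\in(-\pi/2,\pi/2)$, with $D_s=D\sin\theta$, $D_c=D\cos\theta$, define $$\Gamma=\arctan\frac{L/D-\sin\theta}{\cos\theta}+\arctan\frac{L/D+\sin\theta}{\cos\theta},\qquad \psi_2=\frac{\Gamma}{2LD\cos\theta},$$ $$\psi_4=\frac{1}{2D_c^2}\left[\frac{(D^2+L^2)-2D_s^2}{(D^2+L^2)^2-(2LD_s)^2}+\psi_2\right],$$ $$\bar\psi_5=-\frac{(D^2+L^2)D_s}{\left((D^2+L^2)^2-(2LD_s)^2\right)^2},$$ $$\psi_6=\frac{1}{4D_c^2}\,\frac{(D^2+L^2)^2-4D^2D_s^2}{\left((D^2+L^2)^2-(2LD_s)^2\right)^2}+\frac{3}{4D_c^2}\psi_4.$$ Equivalently, for $i=2,4,6$, $\psi_i=\frac1{2L}\int_{-L}^{L}\left((x-D_s)^2+D_c^2\right)^{-i/2}dx$, and $\bar\psi_5=\frac1{2L}\int_{-L}^{L}(x-D_s)\left((x-D_s)^2+D_c^2\right)^{-3}dx$. Put $R=\sqrt{\left[D^4\psi_4-2\cos^2\theta\,(D^6\psi_6)\right]^2+4\cos^2\theta\,(D^5\bar\psi_5)^2}$ and $E=2\cos^4\theta\left[D^6\psi_6\left(D^4\psi_4-\cos^2\theta\,D^6\psi_6\right)-(D^5\bar\psi_5)^2\right]$, and $$\overline{\mathsf{SNR}}^{(1)}=\frac{D^2\psi_2\left[D^4\psi_4-R\right]}{E}-1,\qquad \overline{\mathsf{SNR}}^{(2)}=\frac{D^2\psi_2\left[D^4\psi_4+3R\right]}{E}-1.$$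 The quantities $D^2\psi_2$, $D^4\psi_4$, $D^5\bar\psi_5$, $D^6\psi_6$, hence also $\overline{\mathsf{SNR}}^{(i)}$, depend only on $\theta$ and the ratio $D/L$. Finally, for $i=1,2$, $$\overline{\mathsf{SNR}}_0^{(i)}(\theta,D/L)=\frac{\pi}{4D^2\psi_2}\left(\frac DL\right)^2\overline{\mathsf{SNR}}^{(i)}.$$ *)

theory Defs
  imports Complex_Main "HOL-Library.Landau_Symbols"
begin

definition Gamma_angle :: "real \<Rightarrow> real \<Rightarrow> real \<Rightarrow> real" where
  "Gamma_angle D L \<theta> =
     arctan ((L / D - sin \<theta>) / cos \<theta>) + arctan ((L / D + sin \<theta>) / cos \<theta>)"

(* For D, L > 0 and cos \<theta> > 0, psi2, psi4, psi6 are the closed forms of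
     1/(2L) * integral over x in [-L, L] of ((x - D sin \<theta>)^2 + (D cos \<theta>)^2) powr (-i/2),  i = 2, 4, 6,
   and psi5_bar is the closed form of
     1/(2L) * integral over x in [-L, L] of (x - D sin \<theta>) / ((x - D sin \<theta>)^2 + (D cos \<theta>)^2)^3. *)

definition psi2 :: "real \<Rightarrow> real \<Rightarrow> real \<Rightarrow> real" where
  "psi2 D L \<theta> = Gamma_angle D L \<theta> / (2 * L * D * cos \<theta>)"

definition psi4 :: "real \<Rightarrow> real \<Rightarrow> real \<Rightarrow> real" where
  "psi4 D L \<theta> = (let Ds = D * sin \<theta>; Dc = D * cos \<theta> in
     1 / (2 * Dc^2) *
       (((D^2 + L^2) - 2 * Ds^2) / ((D^2 + L^2)^2 - (2 * L * Ds)^2) + psi2 D L \<theta>))"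

definition psi5_bar :: "real \<Rightarrow> real \<Rightarrow> real \<Rightarrow> real" where
  "psi5_bar D L \<theta> = (let Ds = D * sin \<theta> in
     - (((D^2 + L^2) * Ds) / ((D^2 + L^2)^2 - (2 * L * Ds)^2)^2))"

definition psi6 :: "real \<Rightarrow> real \<Rightarrow> real \<Rightarrow> real" where
  "psi6 D L \<theta> = (let Ds = D * sin \<theta>; Dc = D * cos \<theta> in
     1 / (4 * Dc^2) *
       (((D^2 + L^2)^2 - 4 * D^2 * Ds^2) / ((D^2 + L^2)^2 - (2 * L * Ds)^2)^2)
     + 3 / (4 * Dc^2) * psi4 D L \<theta>)"

definition R_term :: "real \<Rightarrow> real \<Rightarrow> real \<Rightarrow> real" where
  "R_term D L \<theta> =
     sqrt ((D^4 * psi4 D L \<theta> - 2 * (cos \<theta>)^2 * (D^6 * psi6 D L \<theta>))^2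
           + 4 * (cos \<theta>)^2 * (D^5 * psi5_bar D L \<theta>)^2)"

definition E_term :: "real \<Rightarrow> real \<Rightarrow> real \<Rightarrow> real" where
  "E_term D L \<theta> =
     2 * (cos \<theta>)^4 *
       (D^6 * psi6 D L \<theta> * (D^4 * psi4 D L \<theta> - (cos \<theta>)^2 * (D^6 * psi6 D L \<theta>))
        - (D^5 * psi5_bar D L \<theta>)^2)"

definition SNR1_bar :: "real \<Rightarrow> real \<Rightarrow> real \<Rightarrow> real" where
  "SNR1_bar D L \<theta> =
     D^2 * psi2 D L \<theta> * (D^4 * psi4 D L \<theta> - R_term D L \<theta>) / E_term D L \<theta> - 1"

definition SNR2_bar :: "real \<Rightarrow> real \<Rightarrow> real \<Rightarrow> real" where
  "SNR2_bar D L \<theta> =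
     D^2 * psi2 D L \<theta> * (D^4 * psi4 D L \<theta> + 3 * R_term D L \<theta>) / E_term D L \<theta> - 1"

definition SNR1_bar0 :: "real \<Rightarrow> real \<Rightarrow> real \<Rightarrow> real" where
  "SNR1_bar0 D L \<theta> = pi / (4 * D^2 * psi2 D L \<theta>) * (D / L)^2 * SNR1_bar D L \<theta>"

definition SNR2_bar0 :: "real \<Rightarrow> real \<Rightarrow> real \<Rightarrow> real" where
  "SNR2_bar0 D L \<theta> = pi / (4 * D^2 * psi2 D L \<theta>) * (D / L)^2 * SNR2_bar D L \<theta>"

definition B1 :: "real \<Rightarrow> real" where
  "B1 \<theta> = (5 * (cos \<theta>)^4 - 177 * (cos \<theta>)^2 + 128) / 60"

definition B2 :: "real \<Rightarrow> real" where
  "B2 \<theta> = (- 350 * (cos \<theta>)^6 + 10242 * (cos \<theta>)^4 - 19311 * (cos \<theta>)^2 + 10122) / 1575"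

(* The limit D/L \<longrightarrow> \<infinity> over pairs (D, L) with D, L > 0. Bounds along this filter are
   uniform in all pairs with D/L large, so they are bounds in the ratio D/L alone. *)
definition ratio_at_top :: "(real \<times> real) filter" where
  "ratio_at_top = inf (filtercomap (\<lambda>(D, L). D / L) at_top) (principal {(D, L). 0 < D \<and> 0 < L})"

lemma eventually_ratio_at_top:
  "eventually P ratio_at_top \<longleftrightarrow> (\<exists>M. \<forall>D>0. \<forall>L>0. M \<le> D / L \<longrightarrow> P (D, L))"
  unfolding ratio_at_top_def eventually_inf_principal eventually_filtercomap_at_top_linorder
  by auto

end

(* Everything depends on (D, L) only through t = L / D, so the claim is about t -> 0+. All quantities
   have Taylor expansions in t^2 with coefficients polynomial in x = cos^2 \<theta>. The expansion
   of psi2 is obtained by integrating that of the derivative of Gamma, the others by algebra.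
   At t = 0 both E and psi4 - R vanish, and E = 2/3 x^2 t^2 + ..., so each quotient N / E loses one
   order in t^2 and the prefactor (D / L)^2 another one: expansions modulo t^8 leave an error of
   order t^2. *)

theory Submission
  imports Defs "HOL-Real_Asymp.Real_Asymp"
begin

text \<open>The loss of order is structural. For \<open>D = 1\<close> and r^2 = (u - sin \<theta>)^2
  + x, \<open>E_term\<close> is 2 x^2 times the Gram determinant of r^-3 and (u - sin \<theta>) r^-3
  under the mean over u in [-t, t]; it degenerates as the segment shrinks to a point. Moreover R^2 =
  psi4^2 - 2 E / x, so R and psi4 have the same limit, namely 1. Hence the root is taken away from 0
  for every \<theta>, even where 1 - 2 x vanishes. The same identity gives (psi4 - R) / E = 2 / (x
  (psi4 + R)), which stays bounded; this is why the first ratio grows at most like (D/L)^2 and the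
  second like (D/L)^4. Quotients and roots are not computed but proposed, and checked by multiplying
  or squaring back. Every listed coefficient is thus a witness for a polynomial identity in x, and
  passing the coefficients as explicit arguments turns the analysis into rule application plus such
  identities.\<close>

section \<open>Arithmetic of even expansions modulo t^8\<close>

definition even_expansion :: "(real \<Rightarrow> real) \<Rightarrow> real \<Rightarrow> real \<Rightarrow> real \<Rightarrow> real \<Rightarrow> bool" where
  "even_expansion f a b c d \<longleftrightarrow>
     (\<lambda>t. f t - (a + b * t^2 + c * t^4 + d * t^6)) \<in> O[at_right 0](\<lambda>t. t^8)"

lemma power_bigo_power_at_right_0:
  assumes "m \<le> n"
  shows "(\<lambda>t::real. t ^ n) \<in> O[at_right 0](\<lambda>t. t ^ m)"
proof (rule bigoI[where c = 1])
  have "eventually (\<lambda>t::real. t \<in> {0<..<1}) (at_right 0)"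
    by (rule eventually_at_right_real) simp
  then show "eventually (\<lambda>t::real. norm (t ^ n) \<le> 1 * norm (t ^ m)) (at_right 0)"
    by eventually_elim (use assms in \<open>auto intro: power_decreasing\<close>)
qed

lemma even_expansion_poly: "even_expansion (\<lambda>t. a + b * t^2 + c * t^4 + d * t^6) a b c d"
  by (simp add: even_expansion_def)

lemma even_expansion_add:
  assumes "even_expansion f a b c d" "even_expansion g a' b' c' d'"
  shows "even_expansion (\<lambda>t. f t + g t) (a + a') (b + b') (c + c') (d + d')"
  using sum_in_bigo(1)[OF assms[unfolded even_expansion_def]]
  unfolding even_expansion_def by (simp add: algebra_simps)

lemma even_expansion_cmult:
  assumes "even_expansion f a b c d"
  shows "even_expansion (\<lambda>t. k * f t) (k * a) (k * b) (k * c) (k * d)"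
proof -
  have "(\<lambda>t. k * (f t - (a + b * t^2 + c * t^4 + d * t^6))) \<in> O[at_right 0](\<lambda>t. t^8)"
    using assms unfolding even_expansion_def by (cases "k = 0") simp_all
  then show ?thesis
    unfolding even_expansion_def by (simp add: algebra_simps)
qed

lemma even_expansion_diff:
  assumes "even_expansion f a b c d" "even_expansion g a' b' c' d'"
  shows "even_expansion (\<lambda>t. f t - g t) (a - a') (b - b') (c - c') (d - d')"
  using sum_in_bigo(2)[OF assms[unfolded even_expansion_def]]
  unfolding even_expansion_def by (simp add: algebra_simps)

lemma even_expansion_tendsto:
  assumes "even_expansion f a b c d"
  shows "(f \<longlongrightarrow> a) (at_right 0)"
proof -
  define P where "P = (\<lambda>t::real. a + b * t^2 + c * t^4 + d * t^6)"
  have P: "(P \<longlongrightarrow> a) (at_right 0)"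
    unfolding P_def by (auto intro!: tendsto_eq_intros)
  have "(\<lambda>t::real. t^8) \<in> o[at_right 0](\<lambda>_. 1)"
    by (rule smalloI_tendsto) (auto intro!: tendsto_eq_intros)
  from landau_o.big_small_trans[OF assms[unfolded even_expansion_def] this]
  have "((\<lambda>t. f t - P t) \<longlongrightarrow> 0) (at_right 0)"
    by (auto dest: smalloD_tendsto simp: P_def)
  from tendsto_add[OF this P] show ?thesis by simp
qed

lemma even_expansion_bounded:
  assumes "even_expansion f a b c d"
  shows "f \<in> O[at_right 0](\<lambda>_. 1)"
  by (rule bigoI_tendsto[where c = a]) (use even_expansion_tendsto[OF assms] in auto)

lemma bigo_mult_bounded:
  fixes f g h :: "real \<Rightarrow> real"
  assumes "f \<in> O[F](h)" "g \<in> O[F](\<lambda>_. 1)"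
  shows "(\<lambda>t. f t * g t) \<in> O[F](h)"
  using landau_o.big.mult[OF assms] by simp

lemma even_expansion_mult:
  assumes f: "even_expansion f a b c d" and g: "even_expansion g a' b' c' d'"
  shows "even_expansion (\<lambda>t. f t * g t) (a * a') (a * b' + b * a')
           (a * c' + b * b' + c * a') (a * d' + b * c' + c * b' + d * a')"
proof -
  define P where "P = (\<lambda>t::real. a + b * t^2 + c * t^4 + d * t^6)"
  define Q where "Q = (\<lambda>t::real. a' + b' * t^2 + c' * t^4 + d' * t^6)"
  \<comment> \<open>\<open>T\<close> collects the product terms of degree 8, 10 and 12 with t^8
    taken out; the zero coefficient gives it the shape of
    \<open>even_expansion_poly\<close>.\<close>
  define T where "T = (\<lambda>t::real. (b * d' + c * c' + d * b') + (c * d' + d * c') * t^2 + (d * d') * t^4 + 0 * t^6)"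
  have "even_expansion P a b c d" unfolding P_def by (rule even_expansion_poly)
  then have P: "P \<in> O[at_right 0](\<lambda>_. 1)" by (rule even_expansion_bounded)
  have T: "T \<in> O[at_right 0](\<lambda>_. 1)"
    unfolding T_def by (rule even_expansion_bounded[OF even_expansion_poly])
  have 1: "(\<lambda>t. (f t - P t) * g t) \<in> O[at_right 0](\<lambda>t. t^8)"
    using f even_expansion_bounded[OF g] unfolding even_expansion_def P_def
    by (rule bigo_mult_bounded)
  have 2: "(\<lambda>t. (g t - Q t) * P t) \<in> O[at_right 0](\<lambda>t. t^8)"
    using g P unfolding even_expansion_def Q_def by (rule bigo_mult_bounded)
  have 3: "(\<lambda>t. t^8 * T t) \<in> O[at_right 0](\<lambda>t. t^8)"
    using T by (intro bigo_mult_bounded) auto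
  have prod: "P t * Q t = a * a' + (a * b' + b * a') * t^2 + (a * c' + b * b' + c * a') * t^4
         + (a * d' + b * c' + c * b' + d * a') * t^6 + t^8 * T t" for t
    unfolding P_def Q_def T_def by (simp add: algebra_simps flip: power_add)
  have "(f t - P t) * g t + (g t - Q t) * P t + t^8 * T t
      = f t * g t - (a * a' + (a * b' + b * a') * t^2 + (a * c' + b * b' + c * a') * t^4
         + (a * d' + b * c' + c * b' + d * a') * t^6)" for t
    proof -
    have "(f t - P t) * g t + (g t - Q t) * P t = f t * g t - P t * Q t"
      by (simp add: algebra_simps)
    with prod[of t] show ?thesis by linarith
  qed
  then show ?thesis
    unfolding even_expansion_def
    using sum_in_bigo(1)[OF sum_in_bigo(1)[OF 1 2] 3] by simp
qed

lemma even_expansion_times_square: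
  assumes "even_expansion f a b c d"
  shows "even_expansion (\<lambda>t. t^2 * f t) 0 a b c"
  using even_expansion_mult[OF even_expansion_poly[of 0 1 0 0] assms] by simp

lemma even_expansion_bounded_inverse:
  assumes "even_expansion f a b c d" "a \<noteq> 0"
  shows "(\<lambda>t. inverse (f t)) \<in> O[at_right 0](\<lambda>_. 1)"
  by (rule bigoI_tendsto[where c = "inverse a"])
     (use tendsto_inverse[OF even_expansion_tendsto[OF assms(1)] assms(2)] in auto)

lemma even_expansion_eventually_nz:
  assumes "even_expansion f a b c d" "a \<noteq> 0"
  shows "eventually (\<lambda>t. f t \<noteq> 0) (at_right 0)"
  using tendsto_imp_eventually_ne[OF even_expansion_tendsto[OF assms(1)] assms(2)] .

text \<open>Coefficients are compared by separate premises and not by unification, so each use ends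
  in polynomial identities that arithmetic can settle.\<close>

lemma even_expansion_cong:
  assumes "even_expansion f a b c d" "eventually (\<lambda>t. f t = g t) (at_right 0)"
    "a = a'" "b = b'" "c = c'" "d = d'"
  shows "even_expansion g a' b' c' d'"
proof -
  have "eventually (\<lambda>t. f t - (a + b * t^2 + c * t^4 + d * t^6) = g t - (a + b * t^2 + c * t^4 + d * t^6)) (at_right 0)"
    using assms(2) by eventually_elim simp
  from landau_o.big.in_cong[OF this] assms show ?thesis
    unfolding even_expansion_def by simp
qed

text \<open>This is how division is done: with f = h / g the product f g is the known h, and
  \<open>eqs\<close> is the triangular system for the quotient coefficients. The error of f is that
  of (f - P) g times 1 / g, which is bounded because \<open>a\<close> is nonzero.\<close>

lemma even_expansion_cancel:
  assumes g: "even_expansion g a b c d" and "a \<noteq> 0"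
    and fg: "even_expansion (\<lambda>t. f t * g t) A B C E"
    and eqs: "u0 * a = A" "u0 * b + u1 * a = B" "u0 * c + u1 * b + u2 * a = C"
      "u0 * d + u1 * c + u2 * b + u3 * a = E"
  shows "even_expansion f u0 u1 u2 u3"
proof -
  define P where "P = (\<lambda>t::real. u0 + u1 * t^2 + u2 * t^4 + u3 * t^6)"
  have "even_expansion P u0 u1 u2 u3" unfolding P_def by (rule even_expansion_poly)
  from even_expansion_diff[OF fg even_expansion_mult[OF this g]]
  have "even_expansion (\<lambda>t. (f t - P t) * g t) 0 0 0 0"
    by (rule even_expansion_cong, simp add: left_diff_distrib) (use eqs in linarith)+
  then have "(\<lambda>t. (f t - P t) * g t) \<in> O[at_right 0](\<lambda>t. t^8)"
    by (simp add: even_expansion_def)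
  from bigo_mult_bounded[OF this even_expansion_bounded_inverse[OF g \<open>a \<noteq> 0\<close>]]
  have *: "(\<lambda>t. (f t - P t) * g t * inverse (g t)) \<in> O[at_right 0](\<lambda>t. t^8)" .
  have "eventually (\<lambda>t. (f t - P t) * g t * inverse (g t) = f t - P t) (at_right 0)"
    using even_expansion_eventually_nz[OF g \<open>a \<noteq> 0\<close>] by eventually_elim simp
  from landau_o.big.in_cong[OF this] * show ?thesis
    unfolding even_expansion_def P_def by simp
qed

text \<open>Rationalizing gives sqrt f - P = (f - P^2) / (sqrt f + P). The denominator tends to 2 u0
  > 0, so the error of the square passes to the root without loss.\<close>

lemma even_expansion_sqrt:
  assumes f: "even_expansion f A B C E" and "0 < u0"
    and eqs: "u0^2 = A" "2 * u0 * u1 = B" "2 * u0 * u2 + u1^2 = C"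
      "2 * u0 * u3 + 2 * u1 * u2 = E"
  shows "even_expansion (\<lambda>t. sqrt (f t)) u0 u1 u2 u3"
proof -
  define P where "P = (\<lambda>t::real. u0 + u1 * t^2 + u2 * t^4 + u3 * t^6)"
  have P: "even_expansion P u0 u1 u2 u3" unfolding P_def by (rule even_expansion_poly)
  have lim_f: "(f \<longlongrightarrow> u0^2) (at_right 0)"
    using even_expansion_tendsto[OF f] eqs by simp
  have lim: "((\<lambda>t. sqrt (f t) + P t) \<longlongrightarrow> 2 * u0) (at_right 0)"
    using tendsto_add[OF tendsto_real_sqrt[OF lim_f] even_expansion_tendsto[OF P]] \<open>0 < u0\<close> by simp
  have "0 < u0^2" using \<open>0 < u0\<close> by simp
  note pos = order_tendstoD(1)[OF lim_f this] order_tendstoD(1)[OF lim, of 0]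
  from even_expansion_diff[OF f even_expansion_mult[OF P P]]
  have "even_expansion (\<lambda>t. f t - P t * P t) 0 0 0 0"
    by (rule even_expansion_cong) (simp_all add: power2_eq_square flip: eqs)
  then have 1: "(\<lambda>t. f t - P t * P t) \<in> O[at_right 0](\<lambda>t. t^8)"
    by (simp add: even_expansion_def)
  have 2: "(\<lambda>t. inverse (sqrt (f t) + P t)) \<in> O[at_right 0](\<lambda>_. 1)"
    by (rule bigoI_tendsto[where c = "inverse (2 * u0)"])
       (use tendsto_inverse[OF lim] \<open>0 < u0\<close> in auto)
  have "eventually (\<lambda>t. (f t - P t * P t) * inverse (sqrt (f t) + P t) = sqrt (f t) - P t) (at_right 0)"
    using pos(1) pos(2)[simplified, OF \<open>0 < u0\<close>]
  proof eventually_elim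
    case (elim t)
    have "f t - P t * P t = (sqrt (f t) - P t) * (sqrt (f t) + P t)"
      using elim by (simp add: algebra_simps)
    then show ?case using elim by (simp add: field_simps)
  qed
  from landau_o.big.in_cong[OF this] bigo_mult_bounded[OF 1 2] show ?thesis
    unfolding even_expansion_def P_def by simp
qed

section \<open>Integration of an error bound\<close>

text \<open>The mean value theorem replaces integration: f t = t f' \<xi> with \<xi> between 0 and
  t, which gains one power of t.\<close>

lemma bigo_antiderivative:
  fixes f f' :: "real \<Rightarrow> real"
  assumes deriv: "\<And>t. 0 \<le> t \<Longrightarrow> (f has_real_derivative f' t) (at t)" and "f 0 = 0"
    and "f' \<in> O[at_right 0](\<lambda>t. t ^ n)"
  shows "f \<in> O[at_right 0](\<lambda>t. t ^ Suc n)"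
proof -
  obtain C where "eventually (\<lambda>t. norm (f' t) \<le> C * norm (t ^ n)) (at_right 0)"
    using assms(3) by (auto elim: landau_o.bigE)
  then obtain e where "e > 0" and e: "\<And>t. 0 < t \<Longrightarrow> t < e \<Longrightarrow> \<bar>f' t\<bar> \<le> C * t ^ n"
    unfolding eventually_at_right_field by (auto simp: power_abs)
  have bound: "\<bar>f t\<bar> \<le> \<bar>C\<bar> * t ^ Suc n" if t: "0 < t" "t < e" for t
  proof -
    obtain \<xi> where \<xi>: "0 < \<xi>" "\<xi> < t" "f t - f 0 = (t - 0) * f' \<xi>"
      using MVT2[of 0 t f f'] deriv t by auto
    have "\<bar>f' \<xi>\<bar> \<le> C * \<xi> ^ n" using e \<xi> t by simp
    \<comment> \<open>The sign of \<open>C\<close> is unknown, so the monotone step from \<xi> to t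
      goes through its absolute value.\<close>
    also have "\<dots> \<le> \<bar>C\<bar> * t ^ n"
      using \<xi> by (intro mult_mono power_mono) auto
    finally show ?thesis
      using \<xi> t \<open>f 0 = 0\<close> by (simp add: abs_mult mult_left_mono mult.left_commute)
  qed
  show ?thesis
  proof (rule bigoI[where c = "\<bar>C\<bar>"])
    have "eventually (\<lambda>t. t \<in> {0<..<e}) (at_right 0)"
      using \<open>e > 0\<close> by (rule eventually_at_right_real)
    then show "eventually (\<lambda>t. norm (f t) \<le> \<bar>C\<bar> * norm (t ^ Suc n)) (at_right 0)"
      by eventually_elim (use bound in \<open>auto simp: abs_mult power_abs\<close>)
  qed
qed


section \<open>Quotients whose denominator vanishes to second order\<close>

text \<open>For nonzero \<open>b\<close> this fixes the exact order of the denominator: both its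
  nonvanishing near 0 and the size of its inverse follow from this limit.\<close>

lemma even_expansion_leading:
  assumes f: "even_expansion f 0 b c d"
  shows "((\<lambda>t. f t / t^2) \<longlongrightarrow> b) (at_right 0)"
proof -
  have "(\<lambda>t. t^4 * (c + d * t^2)) \<in> O[at_right 0](\<lambda>t. t^4)"
    using even_expansion_bounded[OF even_expansion_poly[of c d 0 0]]
    by (intro bigo_mult_bounded) auto
  also have "(\<lambda>t::real. t^4) \<in> o[at_right 0](\<lambda>t. t^2)"
    by real_asymp
  finally have 1: "(\<lambda>t. t^4 * (c + d * t^2)) \<in> o[at_right 0](\<lambda>t. t^2)" .
  note f[unfolded even_expansion_def]
  also have "(\<lambda>t::real. t^8) \<in> o[at_right 0](\<lambda>t. t^2)"
    by real_asymp
  finally have "(\<lambda>t. (f t - (0 + b * t^2 + c * t^4 + d * t^6)) + t^4 * (c + d * t^2))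
      \<in> o[at_right 0](\<lambda>t. t^2)"
    using 1 by (rule sum_in_smallo)
  then have "((\<lambda>t. (f t - b * t^2) / t^2) \<longlongrightarrow> 0) (at_right 0)"
    by (auto dest!: smalloD_tendsto simp: algebra_simps simp flip: power_add)
  moreover have "eventually (\<lambda>t::real. t \<noteq> 0) (at_right 0)"
    by (simp add: eventually_at_filter)
  then have "eventually (\<lambda>t. (f t - b * t^2) / t^2 = f t / t^2 - b) (at_right 0)"
    by eventually_elim (simp add: field_simps)
  ultimately have "((\<lambda>t. f t / t^2 - b) \<longlongrightarrow> 0) (at_right 0)"
    using tendsto_cong by fast
  then show ?thesis
    by (simp add: LIM_zero_iff)
qed

lemma even_expansion_inverse_bigo:
  assumes f: "even_expansion f 0 b c d" and "b \<noteq> 0"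
  shows "(\<lambda>t. inverse (f t)) \<in> O[at_right 0](\<lambda>t. inverse (t^2))"
proof -
  from tendsto_inverse[OF even_expansion_leading[OF f] \<open>b \<noteq> 0\<close>]
  have "((\<lambda>t. inverse (f t) / inverse (t^2)) \<longlongrightarrow> inverse b) (at_right 0)"
    by (simp add: field_simps)
  then show ?thesis
    by (rule bigoI_tendsto) (simp add: eventually_at_filter)
qed

text \<open>Clearing the pole turns the claim into t^2 N - E K = O(t^8) for the polynomial K = k0 +
  k1 t^2 + k2 t^4. Dividing back by t^2 E, which is of order t^4, leaves O(t^4).\<close>

lemma even_expansion_quotient:
  assumes N: "even_expansion N n0 n1 n2 n3" and E: "even_expansion E 0 e1 e2 e3" and "e1 \<noteq> 0"
    and eqs: "n0 = e1 * k0" "n1 = e1 * k1 + e2 * k0" "n2 = e1 * k2 + e2 * k1 + e3 * k0"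
  shows "(\<lambda>t. N t / E t - (k0 / t^2 + k1 + k2 * t^2)) \<in> O[at_right 0](\<lambda>t. t^4)"
proof -
  define K where "K = (\<lambda>t::real. k0 + k1 * t^2 + k2 * t^4 + 0 * t^6)"
  have "even_expansion K k0 k1 k2 0"
    unfolding K_def by (rule even_expansion_poly)
  from even_expansion_diff[OF even_expansion_times_square[OF N] even_expansion_mult[OF E this]]
  have "even_expansion (\<lambda>t. t^2 * N t - E t * K t) 0 0 0 0"
    by (rule even_expansion_cong) (simp_all add: eqs)
  then have 1: "(\<lambda>t. t^2 * N t - E t * K t) \<in> O[at_right 0](\<lambda>t. t^8)"
    by (simp add: even_expansion_def)
  note inv = even_expansion_inverse_bigo[OF E \<open>e1 \<noteq> 0\<close>]
  have 2: "(\<lambda>t. (t^2 * N t - E t * K t) * (inverse (E t) * inverse (t^2)))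
      \<in> O[at_right 0](\<lambda>t. t^8 * (inverse (t^2) * inverse (t^2)))"
    by (intro landau_o.big.mult 1 inv) simp
  also have "(\<lambda>t::real. t^8 * (inverse (t^2) * inverse (t^2))) \<in> O[at_right 0](\<lambda>t. t^4)"
    by real_asymp
  finally have 3: "(\<lambda>t. (t^2 * N t - E t * K t) * (inverse (E t) * inverse (t^2)))
      \<in> O[at_right 0](\<lambda>t. t^4)" .
  have "eventually (\<lambda>t. E t / t^2 \<noteq> 0) (at_right 0)"
    by (rule tendsto_imp_eventually_ne[OF even_expansion_leading[OF E] \<open>e1 \<noteq> 0\<close>])
  moreover have "eventually (\<lambda>t::real. t \<noteq> 0) (at_right 0)"
    by (simp add: eventually_at_filter)
  ultimately have "eventually (\<lambda>t. (t^2 * N t - E t * K t) * (inverse (E t) * inverse (t^2))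
      = N t / E t - (k0 / t^2 + k1 + k2 * t^2)) (at_right 0)"
    by eventually_elim (auto simp: K_def field_simps power_numeral_reduce)
  from landau_o.big.in_cong[OF this] 3 show ?thesis by simp
qed

section \<open>Expansions of the functions psi, R and E at D = 1\<close>

context
  fixes \<theta> x :: real
  assumes cos_pos: "0 < cos \<theta>" and x: "x = (cos \<theta>)^2"
begin

lemma x_pos: "0 < x"
  using cos_pos by (simp add: x)

lemma sin_squared: "(sin \<theta>)^2 = 1 - x"
  by (simp add: x sin_squared_eq)

text \<open>The common denominator at \<open>D = 1\<close>. It is the product of the squared
  distances from the point (sin \<theta>, cos \<theta>) to the segment ends (t, 0) and (-t, 0),
  which explains its factorization and positivity.\<close>

definition Delta :: "real \<Rightarrow> real" where
  "Delta t = (1 + t^2)^2 - (2 * t * sin \<theta>)^2"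

lemma Delta_factor: "Delta t = (x + (t - sin \<theta>)^2) * (x + (t + sin \<theta>)^2)"
proof -
  have "Delta t = (1 + t^2 - 2 * t * sin \<theta>) * (1 + t^2 + 2 * t * sin \<theta>)"
    unfolding Delta_def by (simp add: algebra_simps power2_eq_square)
  moreover have "1 + t^2 - 2 * t * sin \<theta> = x + (t - sin \<theta>)^2"
    "1 + t^2 + 2 * t * sin \<theta> = x + (t + sin \<theta>)^2"
    using sin_squared by (simp_all add: power2_diff power2_sum)
  ultimately show ?thesis by simp
qed

lemma Delta_pos: "0 < Delta t"
  unfolding Delta_factor using x_pos by (intro mult_pos_pos add_pos_nonneg) auto

lemma Delta_expansion: "even_expansion Delta 1 (4 * x - 2) 1 0"
proof -
  \<comment> \<open>The redundant coefficients 1 and 0 keep the right-hand side literally in the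
    form of \<open>even_expansion_poly\<close>, which \<open>simp only\<close> then matches.\<close>
  have "Delta = (\<lambda>t. 1 + (4 * x - 2) * t^2 + 1 * t^4 + 0 * t^6)"
    unfolding Delta_def power_mult_distrib sin_squared
    by (rule ext) (simp add: algebra_simps power2_eq_square power4_eq_xxxx)
  then show ?thesis by (simp only: even_expansion_poly)
qed

text \<open>Each arctangent contributes cos \<theta> over one squared endpoint distance. The
  derivative is therefore rational in t, and its expansion needs only division by
  \<open>Delta\<close>.\<close>

lemma Gamma_angle_deriv:
  "((\<lambda>t. Gamma_angle 1 t \<theta>) has_real_derivative 2 * cos \<theta> * ((1 + t^2) / Delta t)) (at t)"
proof -
  have cos: "cos \<theta> \<noteq> 0" using cos_pos by simp
  have arctan: "((\<lambda>t. arctan ((t + a) / cos \<theta>)) has_real_derivative cos \<theta> / (x + (t + a)^2)) (at t)" for a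
  proof -
    have "1 + ((t + a) / cos \<theta>)^2 = (x + (t + a)^2) / (cos \<theta>)^2"
      using cos unfolding x by (simp add: field_simps)
    then show ?thesis
      using cos by (auto intro!: derivative_eq_intros simp: field_simps power2_eq_square)
  qed
  have pos: "0 < x + (t - sin \<theta>)^2" "0 < x + (t + sin \<theta>)^2"
    using x_pos by (auto intro: add_pos_nonneg)
  have "cos \<theta> / (x + (t - sin \<theta>)^2) + cos \<theta> / (x + (t + sin \<theta>)^2)
      = cos \<theta> * ((x + (t + sin \<theta>)^2) + (x + (t - sin \<theta>)^2)) / Delta t"
    using pos unfolding Delta_factor by (simp add: field_simps)
  also have "(x + (t + sin \<theta>)^2) + (x + (t - sin \<theta>)^2) = 2 * (1 + t^2)"
    by (simp add: power2_diff power2_sum sin_squared)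
  finally have "cos \<theta> / (x + (t - sin \<theta>)^2) + cos \<theta> / (x + (t + sin \<theta>)^2)
      = 2 * cos \<theta> * ((1 + t^2) / Delta t)"
    by (simp add: algebra_simps)
  then show ?thesis
    using DERIV_add[OF arctan[of "- sin \<theta>"] arctan[of "sin \<theta>"]]
    unfolding Gamma_angle_def by simp
qed

lemma eventually_pos: "eventually (\<lambda>t::real. 0 < t) (at_right 0)"
  by (simp add: eventually_at_filter)

lemma psi2_expansion:
  "even_expansion (\<lambda>t. psi2 1 t \<theta>) 1 (1 - 4/3 * x) (1 - 4 * x + 16/5 * x^2)
     (1 - 8 * x + 16 * x^2 - 64/7 * x^3)"
proof -
  \<comment> \<open>These are q_n = (-1)^n cos ((2n+1) \<theta>) / cos \<theta>: (1 + t^2) / Delta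
    is the even part of 1 / (1 - 2 t sin \<theta> + t^2), the generating function of the Chebyshev
    values U_n(sin \<theta>). Integration divides q_n by 2n+1.\<close>
  define q1 q2 q3 where q: "q1 = 3 - 4 * x" "q2 = 5 - 20 * x + 16 * x^2"
    "q3 = 7 - 56 * x + 112 * x^2 - 64 * x^3"
  have "even_expansion (\<lambda>t. 1 + t^2) 1 1 0 0"
    using even_expansion_poly[of 1 1 0 0] by simp
  then have "even_expansion (\<lambda>t. (1 + t^2) / Delta t * Delta t) 1 1 0 0"
    using Delta_pos less_imp_neq by (auto simp: dual_order.strict_implies_not_eq)
  from even_expansion_cancel[OF Delta_expansion _ this, of 1 q1 q2 q3]
  have "even_expansion (\<lambda>t. (1 + t^2) / Delta t) 1 q1 q2 q3"
    by (simp add: q algebra_simps power2_eq_square power3_eq_cube)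
  note Q = even_expansion_cmult[OF this, of "2 * cos \<theta>", unfolded even_expansion_def]
  define P where "P t = 2 * cos \<theta> * (t + q1 * t^3 / 3 + q2 * t^5 / 5 + q3 * t^7 / 7)" for t
  have "(\<lambda>t. Gamma_angle 1 t \<theta> - P t) \<in> O[at_right 0](\<lambda>t. t ^ Suc 8)"
  proof (rule bigo_antiderivative[OF _ _ Q])
    have "(P has_real_derivative 2 * cos \<theta> * 1 + 2 * cos \<theta> * q1 * t^2 + 2 * cos \<theta> * q2 * t^4
        + 2 * cos \<theta> * q3 * t^6) (at t)" for t
      unfolding P_def by (auto intro!: derivative_eq_intros simp: algebra_simps)
    from DERIV_diff[OF Gamma_angle_deriv this]
    show "((\<lambda>t. Gamma_angle 1 t \<theta> - P t) has_real_derivative 2 * cos \<theta> * ((1 + t^2) / Delta t)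
        - (2 * cos \<theta> * 1 + 2 * cos \<theta> * q1 * t^2 + 2 * cos \<theta> * q2 * t^4 + 2 * cos \<theta> * q3 * t^6)) (at t)" for t .
  \<comment> \<open>What remains is the value at t = 0, where the two arctangents have opposite
    arguments and cancel.\<close>
  qed (simp add: Gamma_angle_def P_def arctan_minus)
  then have "(\<lambda>t. (Gamma_angle 1 t \<theta> - P t) * (inverse (2 * cos \<theta>) * inverse t))
      \<in> O[at_right 0](\<lambda>t. t ^ Suc 8 * (1 * inverse t))"
    by (intro landau_o.big.mult) auto
  also have "(\<lambda>t::real. t ^ Suc 8 * (1 * inverse t)) \<in> O[at_right 0](\<lambda>t. t^8)"
    by real_asymp
  finally have 1: "(\<lambda>t. (Gamma_angle 1 t \<theta> - P t) * (inverse (2 * cos \<theta>) * inverse t))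
      \<in> O[at_right 0](\<lambda>t. t^8)" .
  have "eventually (\<lambda>t. (Gamma_angle 1 t \<theta> - P t) * (inverse (2 * cos \<theta>) * inverse t)
      = psi2 1 t \<theta> - (1 + (1 - 4/3 * x) * t^2 + (1 - 4 * x + 16/5 * x^2) * t^4
          + (1 - 8 * x + 16 * x^2 - 64/7 * x^3) * t^6)) (at_right 0)"
    using eventually_pos
  proof eventually_elim
    case (elim t)
    then have "P t * (inverse (2 * cos \<theta>) * inverse t) = 1 + q1 / 3 * t^2 + q2 / 5 * t^4 + q3 / 7 * t^6"
      using cos_pos unfolding P_def by (simp add: field_simps power_numeral_reduce)
    moreover have "Gamma_angle 1 t \<theta> * (inverse (2 * cos \<theta>) * inverse t) = psi2 1 t \<theta>"
      unfolding psi2_def by (simp add: field_simps)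
    moreover have "q1 / 3 = 1 - 4/3 * x" "q2 / 5 = 1 - 4 * x + 16/5 * x^2"
      "q3 / 7 = 1 - 8 * x + 16 * x^2 - 64/7 * x^3"
      by (simp_all add: q field_simps)
    ultimately show ?case by (simp only: left_diff_distrib)
  qed
  from landau_o.big.in_cong[OF this] 1 show ?thesis
    unfolding even_expansion_def by simp
qed

lemma Delta_nz: "Delta t \<noteq> 0"
  using Delta_pos[of t] by simp

text \<open>The prefactor 1 / (2 x) leaves polynomial coefficients because the constant terms of the
  rational part are all -1 and those of psi2 are all 1, so every summed coefficient is divisible by
  x.\<close>

lemma psi4_expansion:
  "even_expansion (\<lambda>t. psi4 1 t \<theta>) 1 (10/3 - 4 * x) (7 - 112/5 * x + 16 * x^2)
     (12 - 72 * x + 864/7 * x^2 - 64 * x^3)"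
proof -
  have "(\<lambda>t. (1 + t^2 - 2 * (sin \<theta>)^2) / Delta t * Delta t)
      = (\<lambda>t. (2 * x - 1) + 1 * t^2 + 0 * t^4 + 0 * t^6)"
    using Delta_nz by (auto simp: sin_squared)
  then have "even_expansion (\<lambda>t. (1 + t^2 - 2 * (sin \<theta>)^2) / Delta t * Delta t) (2 * x - 1) 1 0 0"
    by (simp only: even_expansion_poly)
  from even_expansion_cancel[OF Delta_expansion _ this, of "- 1 + 2 * x" "- 1 + 8 * x - 8 * x^2"
      "- 1 + 18 * x - 48 * x^2 + 32 * x^3" "- 1 + 32 * x - 160 * x^2 + 256 * x^3 - 128 * x^4"]
  have "even_expansion (\<lambda>t. (1 + t^2 - 2 * (sin \<theta>)^2) / Delta t) (- 1 + 2 * x) (- 1 + 8 * x - 8 * x^2)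
     (- 1 + 18 * x - 48 * x^2 + 32 * x^3) (- 1 + 32 * x - 160 * x^2 + 256 * x^3 - 128 * x^4)"
    by (simp add: algebra_simps power2_eq_square power3_eq_cube power4_eq_xxxx)
  from even_expansion_cmult[OF even_expansion_add[OF this psi2_expansion], of "1 / (2 * x)"]
  show ?thesis
    by (rule even_expansion_cong, simp add: psi4_def Let_def Delta_def x)
      (use x_pos in \<open>simp_all add: field_simps power_numeral_reduce\<close>)
qed

text \<open>Only the square enters R and E, and squaring turns the factor sin \<theta> into 1 - x,
  so x remains the only parameter.\<close>

lemma psi5_bar_squared_expansion:
  "even_expansion (\<lambda>t. (psi5_bar 1 t \<theta>)^2) (1 - x) ((1 - x) * (10 - 16 * x))
     ((1 - x) * (53 - 192 * x + 160 * x^2)) ((1 - x) * (200 - 1216 * x + 2240 * x^2 - 1280 * x^3))"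
proof -
  have "(\<lambda>t. (1 + t^2) / (Delta t * Delta t) * (Delta t * Delta t)) = (\<lambda>t. 1 + 1 * t^2 + 0 * t^4 + 0 * t^6)"
    using Delta_nz by auto
  then have "even_expansion (\<lambda>t. (1 + t^2) / (Delta t * Delta t) * (Delta t * Delta t)) 1 1 0 0"
    by (simp only: even_expansion_poly)
  from even_expansion_cancel[OF even_expansion_mult[OF Delta_expansion Delta_expansion] _ this,
      of 1 "5 - 8 * x" "14 - 56 * x + 48 * x^2" "30 - 216 * x + 432 * x^2 - 256 * x^3"]
  have "even_expansion (\<lambda>t. (1 + t^2) / (Delta t * Delta t)) 1 (5 - 8 * x) (14 - 56 * x + 48 * x^2)
     (30 - 216 * x + 432 * x^2 - 256 * x^3)"
    by (simp add: algebra_simps power2_eq_square power3_eq_cube)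
  note E = even_expansion_cmult[OF even_expansion_mult[OF this this], of "1 - x"]
  have "psi5_bar 1 t \<theta> = - ((1 + t^2) / (Delta t * Delta t) * sin \<theta>)" for t
    by (simp add: psi5_bar_def Let_def Delta_def power2_eq_square)
  then have "(psi5_bar 1 t \<theta>)^2 = (1 - x) * ((1 + t^2) / (Delta t * Delta t) * ((1 + t^2) / (Delta t * Delta t)))" for t
    by (simp only: power2_minus power_mult_distrib sin_squared) (simp only: power2_eq_square mult.commute)
  then show ?thesis
    by (intro even_expansion_cong[OF E]) (simp_all add: algebra_simps power_numeral_reduce)
qed

text \<open>Divisibility by x again makes the coefficients polynomial: the constant terms -3, -10,
  -21, -36 of the rational part cancel against three times the constant terms of psi4.\<close>

lemma psi6_expansion:
  "even_expansion (\<lambda>t. psi6 1 t \<theta>) 1 (7 - 8 * x) (126/5 - 72 * x + 48 * x^2)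
     (66 - 2376/7 * x + 528 * x^2 - 256 * x^3)"
proof -
  have "((1 + t^2)^2 - 4 * (sin \<theta>)^2) / (Delta t * Delta t) * (Delta t * Delta t)
      = (4 * x - 3) + 2 * t^2 + 1 * t^4 + 0 * t^6" for t
  proof -
    have "(1 + t^2)^2 - 4 * (sin \<theta>)^2 = (4 * x - 3) + 2 * t^2 + 1 * t^4 + 0 * t^6"
      unfolding sin_squared by (simp add: power_numeral_reduce algebra_simps)
    then show ?thesis using Delta_nz[of t] by simp
  qed
  then have "even_expansion (\<lambda>t. ((1 + t^2)^2 - 4 * (sin \<theta>)^2) / (Delta t * Delta t) * (Delta t * Delta t))
      (4 * x - 3) 2 1 0"
    by (simp only: even_expansion_poly)
  from even_expansion_cancel[OF even_expansion_mult[OF Delta_expansion Delta_expansion] _ this,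
      of "- 3 + 4 * x" "- 10 + 40 * x - 32 * x^2" "- 21 + 168 * x - 336 * x^2 + 192 * x^3"
      "- 36 + 480 * x - 1728 * x^2 + 2304 * x^3 - 1024 * x^4"]
  have "even_expansion (\<lambda>t. ((1 + t^2)^2 - 4 * (sin \<theta>)^2) / (Delta t * Delta t))
      (- 3 + 4 * x) (- 10 + 40 * x - 32 * x^2) (- 21 + 168 * x - 336 * x^2 + 192 * x^3)
      (- 36 + 480 * x - 1728 * x^2 + 2304 * x^3 - 1024 * x^4)"
    by (simp add: algebra_simps power_numeral_reduce)
  from even_expansion_add[OF even_expansion_cmult[OF this, of "1 / (4 * x)"]
      even_expansion_cmult[OF psi4_expansion, of "3 / (4 * x)"]]
  show ?thesis
    by (rule even_expansion_cong, simp add: psi6_def Let_def Delta_def x power2_eq_square)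
      (use x_pos in \<open>simp_all add: field_simps power_numeral_reduce\<close>)
qed

lemma R_term_expansion:
  "even_expansion (\<lambda>t. R_term 1 t \<theta>) 1 (10/3 - 14/3 * x) (7 - 1136/45 * x + 902/45 * x^2)
     (12 - 2156/27 * x + 9412/63 * x^2 - 15844/189 * x^3)"
proof -
  note A = even_expansion_diff[OF psi4_expansion even_expansion_cmult[OF psi6_expansion, of "2 * x"]]
  note R = even_expansion_add[OF even_expansion_mult[OF A A]
      even_expansion_cmult[OF psi5_bar_squared_expansion, of "4 * x"]]
  \<comment> \<open>The coefficients are left as those of a squared expansion, so that the
    conditions of \<open>even_expansion_sqrt\<close> hold by reflexivity. The leading one is (1 - 2
    x)^2 + 4 x (1 - x) = 1.\<close>
  have "even_expansion (\<lambda>t. (psi4 1 t \<theta> - 2 * x * psi6 1 t \<theta>)^2 + 4 * x * (psi5_bar 1 t \<theta>)^2)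
    (1\<^sup>2) (2 * 1 * (10/3 - 14/3 * x)) (2 * 1 * (7 - 1136/45 * x + 902/45 * x^2) + (10/3 - 14/3 * x)^2)
    (2 * 1 * (12 - 2156/27 * x + 9412/63 * x^2 - 15844/189 * x^3)
      + 2 * (10/3 - 14/3 * x) * (7 - 1136/45 * x + 902/45 * x^2))"
    using R by (rule even_expansion_cong) (simp add: power2_eq_square, (simp add: field_simps power_numeral_reduce)+)
  from even_expansion_sqrt[OF this _ refl refl refl refl]
  show ?thesis
    by (simp add: R_term_def x)
qed

text \<open>The leading coefficient can be read off the Gram determinant: to lowest order the latter
  is the variance t^2 / 3 of the uniform distribution on [-t, t], and the prefactor is 2
  x^2.\<close>

lemma E_term_expansion:
  "even_expansion (\<lambda>t. E_term 1 t \<theta>) 0 (2/3 * x^2) (76/15 * x^2 - 104/15 * x^3)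
     (22 * x^2 - 2368/35 * x^3 + 1728/35 * x^4)"
proof -
  note A = even_expansion_diff[OF psi4_expansion even_expansion_cmult[OF psi6_expansion, of x]]
  note even_expansion_cmult[OF even_expansion_diff[OF even_expansion_mult[OF psi6_expansion A]
      psi5_bar_squared_expansion], of "2 * x^2"]
  then show ?thesis
    by (rule even_expansion_cong)
      (simp add: E_term_def x flip: power_mult, (simp add: field_simps power_numeral_reduce)+)
qed

section \<open>Expansions of the two normalized ratios\<close>

lemma inverse_psi2_expansion:
  "(\<lambda>t. 1 / psi2 1 t \<theta> - (1 + (4/3 * x - 1) * t^2)) \<in> O[at_right 0](\<lambda>t. t^4)"
proof -
  \<comment> \<open>These solve the recursion for the reciprocal series. Only \<open>b\<close>
    survives: the factor t^-2 applied later turns an error t^4 into the permitted t^2, so the terms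
    with \<open>c\<close> and \<open>d\<close> are absorbed.\<close>
  define b c d where "b = 4/3 * x - 1" "c = - (b * (1 - 4/3 * x) + (1 - 4 * x + 16/5 * x^2))"
    "d = - (c * (1 - 4/3 * x) + b * (1 - 4 * x + 16/5 * x^2) + (1 - 8 * x + 16 * x^2 - 64/7 * x^3))"
  note bcd = this
  note ne = even_expansion_eventually_nz[OF psi2_expansion]
  have "even_expansion (\<lambda>t. 1 / psi2 1 t \<theta> * psi2 1 t \<theta>) 1 0 0 0"
    by (rule even_expansion_cong[OF even_expansion_poly[of 1 0 0 0]])
       (use ne in \<open>auto elim: eventually_mono\<close>)
  from even_expansion_cancel[OF psi2_expansion _ this, of 1 b c d]
  have "even_expansion (\<lambda>t. 1 / psi2 1 t \<theta>) 1 b c d"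
    by (simp add: bcd algebra_simps)
  note this[unfolded even_expansion_def]
  also have "(\<lambda>t::real. t^8) \<in> O[at_right 0](\<lambda>t. t^4)"
    by (rule power_bigo_power_at_right_0) simp
  finally have 1: "(\<lambda>t. 1 / psi2 1 t \<theta> - (1 + b * t^2 + c * t^4 + d * t^6)) \<in> O[at_right 0](\<lambda>t. t^4)" .
  have "(\<lambda>t. t^4 * (c + d * t^2)) \<in> O[at_right 0](\<lambda>t. t^4)"
    using even_expansion_bounded[OF even_expansion_poly[of c d 0 0]]
    by (intro bigo_mult_bounded) auto
  from sum_in_bigo(1)[OF 1 this] show ?thesis
    by (simp add: bcd(1) algebra_simps flip: power_add)
qed

text \<open>Covers both ratios through the numerator \<open>N\<close>. The prefactor cancels psi2 in
  the main term, leaving pi / 4 * t^-2 * (N / E - 1 / psi2), so psi2 enters only through its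
  reciprocal; that is the source of the -1 and of the 1 - 4/3 x.\<close>

lemma SNR_expansion:
  assumes N: "even_expansion N n0 n1 n2 n3"
    and eqs: "n0 = 2/3 * x^2 * k0" "n1 = 2/3 * x^2 * k1 + (76/15 * x^2 - 104/15 * x^3) * k0"
      "n2 = 2/3 * x^2 * k2 + (76/15 * x^2 - 104/15 * x^3) * k1
        + (22 * x^2 - 2368/35 * x^3 + 1728/35 * x^4) * k0"
  shows "(\<lambda>t. pi / (4 * psi2 1 t \<theta>) * (1 / t)^2 * (psi2 1 t \<theta> * N t / E_term 1 t \<theta> - 1)
      - pi / 4 * (k0 * (1 / t)^4 + (k1 - 1) * (1 / t)^2 + (k2 + 1 - 4/3 * x))) \<in> O[at_right 0](\<lambda>t. t^2)"
proof -
  have "2/3 * x^2 \<noteq> 0" using x_pos by simp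
  from sum_in_bigo(2)[OF even_expansion_quotient[OF N E_term_expansion this eqs] inverse_psi2_expansion]
  have "(\<lambda>t. (pi / 4 * (1 / t)^2) * (N t / E_term 1 t \<theta> - (k0 / t^2 + k1 + k2 * t^2)
        - (1 / psi2 1 t \<theta> - (1 + (4/3 * x - 1) * t^2)))) \<in> O[at_right 0](\<lambda>t. (pi / 4 * (1 / t)^2) * t^4)"
    by (rule landau_o.big.mult_left)
  also have "(\<lambda>t::real. (pi / 4 * (1 / t)^2) * t^4) \<in> O[at_right 0](\<lambda>t. t^2)"
    by real_asymp
  finally have 1: "(\<lambda>t. (pi / 4 * (1 / t)^2) * (N t / E_term 1 t \<theta> - (k0 / t^2 + k1 + k2 * t^2)
        - (1 / psi2 1 t \<theta> - (1 + (4/3 * x - 1) * t^2)))) \<in> O[at_right 0](\<lambda>t. t^2)" .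
  have "eventually (\<lambda>t. (pi / 4 * (1 / t)^2) * (N t / E_term 1 t \<theta> - (k0 / t^2 + k1 + k2 * t^2)
        - (1 / psi2 1 t \<theta> - (1 + (4/3 * x - 1) * t^2)))
      = pi / (4 * psi2 1 t \<theta>) * (1 / t)^2 * (psi2 1 t \<theta> * N t / E_term 1 t \<theta> - 1)
      - pi / 4 * (k0 * (1 / t)^4 + (k1 - 1) * (1 / t)^2 + (k2 + 1 - 4/3 * x))) (at_right 0)"
    using even_expansion_eventually_nz[OF psi2_expansion one_neq_zero] eventually_pos
  proof eventually_elim
    case (elim t)
    then have "pi / (4 * psi2 1 t \<theta>) * (1 / t)^2 * (psi2 1 t \<theta> * N t / E_term 1 t \<theta> - 1)
      = (pi / 4 * (1 / t)^2) * (N t / E_term 1 t \<theta> - 1 / psi2 1 t \<theta>)"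
      by (simp add: right_diff_distrib)
    moreover have "(1 / t)^2 * (k0 / t^2 + k1 + k2 * t^2 - (1 + (4/3 * x - 1) * t^2))
      = k0 * (1 / t)^4 + (k1 - 1) * (1 / t)^2 + (k2 + 1 - 4/3 * x)"
      using elim by (simp add: field_simps power_numeral_reduce)
    \<comment> \<open>Stated for arbitrary reals so that the facts above can be combined by plain
      rewriting, without expanding the quotients inside.\<close>
    moreover have "(c * y) * (A - K - (B - U)) = (c * y) * (A - B) - c * (y * (K - U))"
      for c y A B K U :: real
      by (simp add: algebra_simps)
    ultimately show ?case
      by (simp only:)
  qed
  from landau_o.big.in_cong[OF this] 1 show ?thesis by simp
qed

text \<open>Here psi4 - R starts at 2/3 x t^2, so k0 = 0 and k1 = 1 / x; the surviving coefficient
  k1 - 1 = 1 / x - 1 is the squared tangent.\<close>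

lemma SNR1_bar0_expansion:
  "(\<lambda>t. SNR1_bar0 1 t \<theta> - pi / 4 * ((1 / t)^2 * (tan \<theta>)^2
      - (4 * (cos \<theta>)^4 - 16 * (cos \<theta>)^2 + 10) / (3 * (cos \<theta>)^2))) \<in> O[at_right 0](\<lambda>t. t^2)"
proof -
  have tan: "(tan \<theta>)^2 = 1 / x - 1"
    using x_pos by (simp add: tan_def power_divide sin_squared field_simps flip: x)
  have const: "(4 * (cos \<theta>)^4 - 16 * (cos \<theta>)^2 + 10) / (3 * (cos \<theta>)^2)
      = - ((13/3 * x - 10/3) / x + 1 - 4/3 * x)"
    using cos_pos unfolding x by (simp add: field_simps power_numeral_reduce)
  note N = even_expansion_diff[OF psi4_expansion R_term_expansion]
  have "(\<lambda>t. pi / (4 * psi2 1 t \<theta>) * (1 / t)^2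
        * (psi2 1 t \<theta> * (psi4 1 t \<theta> - R_term 1 t \<theta>) / E_term 1 t \<theta> - 1)
      - pi / 4 * (0 * (1 / t)^4 + (1 / x - 1) * (1 / t)^2 + ((13/3 * x - 10/3) / x + 1 - 4/3 * x)))
      \<in> O[at_right 0](\<lambda>t. t^2)"
    by (rule SNR_expansion[OF N]) (use x_pos in \<open>simp_all add: field_simps power_numeral_reduce\<close>)
  then show ?thesis
    unfolding const tan diff_minus_eq_add by (simp add: SNR1_bar0_def SNR1_bar_def mult.commute)
qed

lemma SNR2_bar0_expansion:
  "(\<lambda>t. SNR2_bar0 1 t \<theta> - 3 * pi / (2 * (cos \<theta>)^4) *
      ((1 / t)^4 - 2 * B1 \<theta> * (1 / t)^2 + B2 \<theta>)) \<in> O[at_right 0](\<lambda>t. t^2)"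
proof -
  \<comment> \<open>Quotient coefficients of (psi4 + 3 R) / E after k0 = 4 / (2/3 x^2) = 6 / x^2.
    The highest powers of the cosine in \<open>B1\<close> and \<open>B2\<close> come from the
    corrections -1 and -4/3 x due to 1 / psi2.\<close>
  define k1 k2 where k: "k1 = (177/5 * x - 128/5) / x^2"
    "k2 = (964/25 - 12874/175 * x + 6653/175 * x^2) / x^2"
  have x4: "(cos \<theta>)^4 = x^2" by (simp add: x flip: power_mult)
  have x6: "(cos \<theta>)^6 = x^3" by (simp add: x flip: power_mult)
  have main: "3 * pi / (2 * (cos \<theta>)^4) * ((1 / t)^4 - 2 * B1 \<theta> * (1 / t)^2 + B2 \<theta>)
      = pi / 4 * (6 / x^2 * (1 / t)^4 + (k1 - 1) * (1 / t)^2 + (k2 + 1 - 4/3 * x))" for t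
  proof -
    have "6 / x^2 * (- 2 * B1 \<theta>) = k1 - 1" "6 / x^2 * B2 \<theta> = k2 + 1 - 4/3 * x"
      using x_pos unfolding B1_def B2_def x4 x6 k x[symmetric]
      by (simp_all add: field_simps power_numeral_reduce)
    moreover have "r * (u - 2 * B * v + C) = r * u + r * (- 2 * B) * v + r * C" for r u v B C :: real
      by (simp add: algebra_simps)
    ultimately have "6 / x^2 * ((1 / t)^4 - 2 * B1 \<theta> * (1 / t)^2 + B2 \<theta>)
        = 6 / x^2 * (1 / t)^4 + (k1 - 1) * (1 / t)^2 + (k2 + 1 - 4/3 * x)"
      by (simp only:)
    moreover have "3 * pi / (2 * x^2) = pi / 4 * (6 / x^2)" by simp
    ultimately show ?thesis unfolding x4 by (simp only: mult.assoc)
  qed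
  note N = even_expansion_add[OF psi4_expansion even_expansion_cmult[OF R_term_expansion, of 3]]
  have "(\<lambda>t. pi / (4 * psi2 1 t \<theta>) * (1 / t)^2
        * (psi2 1 t \<theta> * (psi4 1 t \<theta> + 3 * R_term 1 t \<theta>) / E_term 1 t \<theta> - 1)
      - pi / 4 * (6 / x^2 * (1 / t)^4 + (k1 - 1) * (1 / t)^2 + (k2 + 1 - 4/3 * x)))
      \<in> O[at_right 0](\<lambda>t. t^2)"
    by (rule SNR_expansion[OF N]) (use x_pos in \<open>simp_all add: k field_simps power_numeral_reduce\<close>)
  then show ?thesis
    unfolding main by (simp add: SNR2_bar0_def SNR2_bar_def)
qed

end

section \<open>Homogeneity: reduction to D = 1\<close>

lemma psi2_scale: "D > 0 \<Longrightarrow> D^2 * psi2 D L \<theta> = psi2 1 (L / D) \<theta>"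
proof -
  assume D: "D > 0"
  then have "Gamma_angle D L \<theta> = Gamma_angle 1 (L / D) \<theta>"
    by (simp add: Gamma_angle_def)
  then show ?thesis
    using D by (simp add: psi2_def power2_eq_square mult.commute)
qed

context
  fixes D L \<theta> :: real
  assumes D: "D > 0"
begin

lemma Delta_scale:
  "(D^2 + L^2)^2 - (2 * L * (D * sin \<theta>))^2 = D^4 * ((1 + (L / D)^2)^2 - (2 * (L / D) * sin \<theta>)^2)"
  using D by (simp add: field_simps power_numeral_reduce)

lemma sum_scale: "D^2 + L^2 = D^2 * (1 + (L / D)^2)"
  using D by (simp add: field_simps)

lemma psi4_scale: "D^4 * psi4 D L \<theta> = psi4 1 (L / D) \<theta>"
proof -
  define W where "W = (1 + (L / D)^2)^2 - (2 * (L / D) * sin \<theta>)^2"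
  define S where "S = 1 + (L / D)^2"
  have "D^2 + L^2 - 2 * (D * sin \<theta>)^2 = D^2 * (S - 2 * (sin \<theta>)^2)"
    unfolding S_def sum_scale by (simp add: algebra_simps power_mult_distrib)
  then have "(D^2 + L^2 - 2 * (D * sin \<theta>)^2) / ((D^2 + L^2)^2 - (2 * L * (D * sin \<theta>))^2)
      = (S - 2 * (sin \<theta>)^2) / W / D^2"
    unfolding Delta_scale W_def[symmetric] using D by (simp add: power_numeral_reduce)
  moreover have "psi2 D L \<theta> = psi2 1 (L / D) \<theta> / D^2"
    using psi2_scale[of D L \<theta>] D by (simp add: field_simps)
  \<comment> \<open>With the two summands abstracted to X and Y, only the powers of D have to
    cancel.\<close>
  moreover have "D^4 * (1 / (2 * (D * cos \<theta>)^2) * (X / D^2 + Y / D^2)) = 1 / (2 * (cos \<theta>)^2) * (X + Y)" for X Y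
    unfolding add_divide_distrib[symmetric] using D by (simp add: power_mult_distrib power_numeral_reduce)
  ultimately have "D^4 * psi4 D L \<theta>
      = 1 / (2 * (cos \<theta>)^2) * ((S - 2 * (sin \<theta>)^2) / W + psi2 1 (L / D) \<theta>)"
    unfolding psi4_def Let_def by (simp only:)
  then show ?thesis by (simp add: psi4_def S_def W_def Let_def)
qed

lemma psi5_bar_scale: "D^5 * psi5_bar D L \<theta> = psi5_bar 1 (L / D) \<theta>"
proof -
  define W where "W = (1 + (L / D)^2)^2 - (2 * (L / D) * sin \<theta>)^2"
  define S where "S = 1 + (L / D)^2"
  have "D^5 * psi5_bar D L \<theta> = - (S * sin \<theta> / W^2)"
    \<comment> \<open>The order matters: rewriting D^2 + L^2 first would destroy the pattern of
      \<open>Delta_scale\<close>.\<close>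
    unfolding psi5_bar_def Let_def Delta_scale W_def[symmetric] unfolding sum_scale S_def[symmetric]
    using D by (simp add: power_mult_distrib power_numeral_reduce)
  then show ?thesis by (simp add: psi5_bar_def S_def W_def Let_def)
qed

lemma psi6_scale: "D^6 * psi6 D L \<theta> = psi6 1 (L / D) \<theta>"
proof -
  define W where "W = (1 + (L / D)^2)^2 - (2 * (L / D) * sin \<theta>)^2"
  define S where "S = 1 + (L / D)^2"
  have "(D^2 + L^2)^2 - 4 * D^2 * (D * sin \<theta>)^2 = D^4 * (S^2 - 4 * (sin \<theta>)^2)"
    unfolding sum_scale S_def[symmetric] by (simp add: algebra_simps power_numeral_reduce)
  then have "((D^2 + L^2)^2 - 4 * D^2 * (D * sin \<theta>)^2) / ((D^2 + L^2)^2 - (2 * L * (D * sin \<theta>))^2)^2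
      = (S^2 - 4 * (sin \<theta>)^2) / W^2 / D^4"
    unfolding Delta_scale W_def[symmetric] using D by (simp add: power_numeral_reduce)
  moreover have "psi4 D L \<theta> = psi4 1 (L / D) \<theta> / D^4"
    using psi4_scale D by (simp add: field_simps)
  ultimately have "D^6 * psi6 D L \<theta>
      = 1 / (4 * (cos \<theta>)^2) * ((S^2 - 4 * (sin \<theta>)^2) / W^2) + 3 / (4 * (cos \<theta>)^2) * psi4 1 (L / D) \<theta>"
    using D unfolding psi6_def Let_def
    by (simp add: power_mult_distrib power_numeral_reduce distrib_left)
  then show ?thesis by (simp add: psi6_def S_def W_def Let_def)
qed

lemma R_term_scale: "R_term D L \<theta> = R_term 1 (L / D) \<theta>"
  unfolding R_term_def psi4_scale psi5_bar_scale psi6_scale by simp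

lemma E_term_scale: "E_term D L \<theta> = E_term 1 (L / D) \<theta>"
  unfolding E_term_def psi4_scale psi5_bar_scale psi6_scale by simp

lemma SNR1_bar0_scale: "SNR1_bar0 D L \<theta> = SNR1_bar0 1 (L / D) \<theta>"
  \<comment> \<open>Reassociating after the factor 4 exposes D^2 * psi2, the scale-invariant
    combination.\<close>
  unfolding SNR1_bar0_def SNR1_bar_def mult.assoc[of 4] psi2_scale[OF D] psi4_scale R_term_scale E_term_scale
  by simp

lemma SNR2_bar0_scale: "SNR2_bar0 D L \<theta> = SNR2_bar0 1 (L / D) \<theta>"
  unfolding SNR2_bar0_def SNR2_bar_def mult.assoc[of 4] psi2_scale[OF D] psi4_scale R_term_scale E_term_scale
  by simp

end

section \<open>Transfer from t tending to 0 to the ratio tending to infinity\<close>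

lemma filterlim_ratio: "filterlim (\<lambda>(D, L). L / D) (at_right 0) ratio_at_top"
proof -
  have "filterlim (\<lambda>p. case p of (D, L) \<Rightarrow> D / L) at_top ratio_at_top"
    unfolding ratio_at_top_def by (rule filterlim_mono[OF filterlim_filtercomap order_refl inf_le1])
  from filterlim_compose[OF filterlim_inverse_at_right_top this]
  show ?thesis by (simp add: case_prod_unfold inverse_eq_divide)
qed

text \<open>A bound in the single variable t is composed with L / D. Agreement on positive pairs
  suffices because \<open>ratio_at_top\<close> is confined to them.\<close>

lemma ratio_at_top_bigo_transfer:
  fixes f :: "real \<Rightarrow> real" and g :: "real \<times> real \<Rightarrow> real"
  assumes f: "f \<in> O[at_right 0](\<lambda>t. t^2)"
    and fg: "\<And>D L. 0 < D \<Longrightarrow> 0 < L \<Longrightarrow> f (L / D) = g (D, L)"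
  shows "g \<in> O[ratio_at_top](\<lambda>(D, L). (L / D)^2)"
proof -
  have "(\<lambda>p. f (case p of (D, L) \<Rightarrow> L / D)) \<in> O[ratio_at_top](\<lambda>p. (case p of (D, L) \<Rightarrow> L / D)^2)"
    using f filterlim_ratio by (rule landau_o.big.compose)
  moreover have "eventually (\<lambda>p. f (case p of (D, L) \<Rightarrow> L / D) = g p) ratio_at_top"
    unfolding eventually_ratio_at_top by (auto simp: fg)
  ultimately show ?thesis
    using landau_o.big.in_cong by (force simp: case_prod_unfold)
qed

theorem mainTheorem6:
  fixes \<theta> :: real
  assumes "- (pi / 2) < \<theta>" and "\<theta> < pi / 2"
  shows "(\<lambda>(D, L). SNR1_bar0 D L \<theta>
            - pi / 4 * ((D / L)^2 * (tan \<theta>)^2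
                - (4 * (cos \<theta>)^4 - 16 * (cos \<theta>)^2 + 10) / (3 * (cos \<theta>)^2)))
           \<in> O[ratio_at_top](\<lambda>(D, L). (L / D)^2)
       \<and> (\<lambda>(D, L). SNR2_bar0 D L \<theta>
            - 3 * pi / (2 * (cos \<theta>)^4) *
                ((D / L)^4 - 2 * B1 \<theta> * (D / L)^2 + B2 \<theta>))
           \<in> O[ratio_at_top](\<lambda>(D, L). (L / D)^2)"
proof -
  have "0 < cos \<theta>" using assms by (rule cos_gt_zero_pi)
  note expansions = SNR1_bar0_expansion[OF this refl] SNR2_bar0_expansion[OF this refl]
  show ?thesis
    by (intro conjI ratio_at_top_bigo_transfer[OF expansions(1)] ratio_at_top_bigo_transfer[OF expansions(2)])
      (simp_all add: SNR1_bar0_scale[symmetric] SNR2_bar0_scale[symmetric])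
qed

end
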